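(* Let $E$ be a Banach algebra and let $X$ be a nonempty closed convex subset of $E$. Let $A,B:X\to E$ be two operators such that: (i) $A$ and $B$ are $\mathcal D$-Lipschitzian with $\mathcal D$-functions $\varphi$ and $\psi$ respectively; (ii) $A(X)$ and $B(X)$ are bounded; (iii) $Ax\cdot Bx\in X$ for all $x\in X$. Suppose that $\|A(X)\|\,\psi(r)+\|B(X)\|\,\varphi(r)<r$ for all $r>0$. Then there is a unique point $\tilde x\in X$ such that $A\tilde x\cdot B\tilde x=\tilde x$, and for every $x\in X$ the sequence $\{(A\cdot B)^n x\}_{n}$ converges to $\tilde x$.
   Context: A mapping $A:X\to E$ is $\mathcal D$-Lipschitzian if there is a continuous nondecreasing function $\phi:\mathbb R_+\to\mathbb R_+$ with $\phi(0)=0$ such that $\|Ax-Ay\|\le\phi(\|x-y\|)$ for all $x,y\in X$; $\phi$ is called the $\mathcal D$-function associated to $A$. For a bounded set $S\subset E$, $\|S\|:=\sup\{\|s\|:s\in S\}$. $A\cdot B:X\to X$ is the operator $(A\cdot B)x=Ax\cdot Bx$ (product in $E$), and $(A\cdot B)^n$ denotes its $n$-fold composition with itself. *)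

theory Defs
  imports "HOL-Analysis.Analysis"
begin

text \<open>
  Maps \<open>\<real>\<^sub>+ \<rightarrow> \<real>\<^sub>+\<close> and \<open>X \<rightarrow> E\<close> are total functions, constrained only on
  \<open>{0..}\<close> and on \<open>X\<close>, respectively.
\<close>

definition D_function :: "(real \<Rightarrow> real) \<Rightarrow> bool" where
  "D_function \<phi> \<longleftrightarrow>
     \<phi> \<in> {0..} \<rightarrow> {0..} \<and> continuous_on {0..} \<phi> \<and> mono_on {0..} \<phi> \<and> \<phi> 0 = 0"

definition D_Lipschitzian_with ::
    "(real \<Rightarrow> real) \<Rightarrow> 'a::real_normed_vector set \<Rightarrow> ('a \<Rightarrow> 'a) \<Rightarrow> bool" where
  "D_Lipschitzian_with \<phi> X A \<longleftrightarrow>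
     D_function \<phi> \<and> (\<forall>x\<in>X. \<forall>y\<in>X. norm (A x - A y) \<le> \<phi> (norm (x - y)))"

text \<open>Meaningful for nonempty bounded \<open>S\<close> only.\<close>

definition set_norm :: "'a::real_normed_vector set \<Rightarrow> real" where
  "set_norm S = (SUP s\<in>S. norm s)"

definition op_prod :: "('a \<Rightarrow> 'a) \<Rightarrow> ('a \<Rightarrow> 'a) \<Rightarrow> 'a::real_normed_algebra \<Rightarrow> 'a" where
  "op_prod A B = (\<lambda>x. A x * B x)"

end

theory Submission
  imports Defs
begin

text \<open>
  Write \<open>T x = A x * B x\<close>. Splitting
  \<open>T x - T y = A x * (B x - B y) + (A x - A y) * B y\<close> shows
  \<open>\<parallel>T x - T y\<parallel> \<le> \<Phi> \<parallel>x - y\<parallel>\<close> with \<open>\<Phi> r = \<parallel>A(X)\<parallel> \<psi> r + \<parallel>B(X)\<parallel> \<phi> r\<close>, a continuous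
  nondecreasing function below the identity on the positive reals. So \<open>T\<close> is a nonlinear
  contraction of the complete set \<open>X\<close>, and the fixed point theorem of Boyd and Wong applies.

  That theorem is proved here for nondecreasing \<open>\<Phi>\<close>. The steps \<open>dist (T\<^sup>n x) (T\<^sup>n\<^sup>+\<^sup>1 x)\<close>
  decrease to a limit \<open>d \<le> \<Phi> d\<close>, which forces \<open>d = 0\<close>
  (\<open>contraction_steps_tendsto_zero\<close>). Once a step at \<open>a\<close> is
  shorter than \<open>\<epsilon> - \<Phi> \<epsilon>\<close>, the map \<open>T\<close> sends the \<open>\<epsilon>\<close>-ball of \<open>X\<close> around \<open>a\<close> into
  itself (\<open>contraction_orbit_in_cball\<close>), so the orbit is Cauchy. Its limit is fixed because \<open>T\<close> is
  nonexpansive, and two fixed points at distance \<open>r > 0\<close> would give \<open>r \<le> \<Phi> r < r\<close>.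
\<close>

section \<open>Nonlinear contractions of complete sets\<close>

lemma funpow_in_invariant_set:
  assumes "\<And>x. x \<in> X \<Longrightarrow> T x \<in> X" and "x \<in> X"
  shows "(T ^^ n) x \<in> X"
  using assms by (induction n) auto

lemma contraction_nonexpansive:
  fixes T :: "'a::metric_space \<Rightarrow> 'a"
  assumes "\<And>x y. x \<in> X \<Longrightarrow> y \<in> X \<Longrightarrow> dist (T x) (T y) \<le> \<Phi> (dist x y)"
    and "\<And>r::real. r > 0 \<Longrightarrow> \<Phi> r < r"
    and "x \<in> X" "y \<in> X"
  shows "dist (T x) (T y) \<le> dist x y"
proof (cases "x = y")
  case False
  then show ?thesis
    using assms(1)[OF assms(3,4)] assms(2)[of "dist x y"] by simp
qed simp

text \<open>
  The steps are nonincreasing and nonnegative, hence converge to some \<open>d\<close>. Passing to the limit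
  in \<open>d\<^sub>n\<^sub>+\<^sub>1 \<le> \<Phi> d\<^sub>n\<close> by continuity gives \<open>d \<le> \<Phi> d\<close>, which is impossible for \<open>d > 0\<close>.
\<close>

lemma contraction_steps_tendsto_zero:
  fixes T :: "'a::metric_space \<Rightarrow> 'a"
  assumes inv: "\<And>x. x \<in> X \<Longrightarrow> T x \<in> X"
    and contr: "\<And>x y. x \<in> X \<Longrightarrow> y \<in> X \<Longrightarrow> dist (T x) (T y) \<le> \<Phi> (dist x y)"
    and below: "\<And>r::real. r > 0 \<Longrightarrow> \<Phi> r < r"
    and cont: "continuous_on {0..} \<Phi>"
    and "x \<in> X"
  shows "(\<lambda>n. dist ((T ^^ n) x) (T ((T ^^ n) x))) \<longlonglongrightarrow> 0"
proof -
  define d where "d n = dist ((T ^^ n) x) (T ((T ^^ n) x))" for n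
  have orbit: "(T ^^ n) x \<in> X" for n
    using inv \<open>x \<in> X\<close> by (rule funpow_in_invariant_set)
  have step: "d (Suc n) \<le> \<Phi> (d n)" for n
    unfolding d_def using contr[OF orbit inv[OF orbit], of n n] by simp
  have "decseq d"
  proof (rule decseq_SucI)
    fix n
    show "d (Suc n) \<le> d n"
      unfolding d_def
      using contraction_nonexpansive[OF contr below orbit inv[OF orbit], of n n] by simp
  qed
  moreover have nonneg: "0 \<le> d n" for n
    by (simp add: d_def)
  ultimately obtain l where l: "d \<longlonglongrightarrow> l"
    using decseq_convergent by metis
  have "0 \<le> l"
    using l nonneg by (simp add: LIMSEQ_le_const)
  have "(\<lambda>n. \<Phi> (d n)) \<longlonglongrightarrow> \<Phi> l"
    using continuous_on_tendsto_compose[OF cont l] \<open>0 \<le> l\<close> nonneg by simp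
  then have "l \<le> \<Phi> l"
    using LIMSEQ_le[OF LIMSEQ_Suc[OF l]] step by blast
  then have "l = 0"
    using below[of l] \<open>0 \<le> l\<close> by force
  with l show ?thesis
    by (simp add: d_def[abs_def])
qed

text \<open>
  If \<open>b\<close> is within \<open>\<epsilon>\<close> of \<open>a\<close>, then
  \<open>dist a (T b) \<le> dist a (T a) + dist (T a) (T b) \<le> (\<epsilon> - \<Phi> \<epsilon>) + \<Phi> \<epsilon> = \<epsilon>\<close>. Monotonicity of
  \<open>\<Phi>\<close> is what bounds the second summand for all such \<open>b\<close> at once.
\<close>

lemma contraction_orbit_in_cball:
  fixes T :: "'a::metric_space \<Rightarrow> 'a"
  assumes inv: "\<And>x. x \<in> X \<Longrightarrow> T x \<in> X"
    and contr: "\<And>x y. x \<in> X \<Longrightarrow> y \<in> X \<Longrightarrow> dist (T x) (T y) \<le> \<Phi> (dist x y)"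
    and mono: "mono_on {0..} \<Phi>"
    and "a \<in> X" and "\<epsilon> \<ge> 0"
    and short: "dist a (T a) \<le> \<epsilon> - \<Phi> \<epsilon>"
  shows "dist a ((T ^^ n) a) \<le> \<epsilon>"
proof (induction n)
  case 0
  show ?case using \<open>\<epsilon> \<ge> 0\<close> by simp
next
  case (Suc n)
  let ?b = "(T ^^ n) a"
  have "?b \<in> X"
    using inv \<open>a \<in> X\<close> by (rule funpow_in_invariant_set)
  then have "dist (T a) (T ?b) \<le> \<Phi> (dist a ?b)"
    using contr \<open>a \<in> X\<close> by blast
  also have "\<dots> \<le> \<Phi> \<epsilon>"
    using mono Suc \<open>\<epsilon> \<ge> 0\<close> by (auto intro: mono_onD)
  finally show ?case
    using short dist_triangle[of a "T ?b" "T a"] by simp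
qed

lemma contraction_orbit_Cauchy:
  fixes T :: "'a::metric_space \<Rightarrow> 'a"
  assumes inv: "\<And>x. x \<in> X \<Longrightarrow> T x \<in> X"
    and contr: "\<And>x y. x \<in> X \<Longrightarrow> y \<in> X \<Longrightarrow> dist (T x) (T y) \<le> \<Phi> (dist x y)"
    and below: "\<And>r::real. r > 0 \<Longrightarrow> \<Phi> r < r"
    and cont: "continuous_on {0..} \<Phi>" and mono: "mono_on {0..} \<Phi>"
    and "x \<in> X"
  shows "Cauchy (\<lambda>n. (T ^^ n) x)"
proof (rule metric_CauchyI)
  fix e :: real
  assume "e > 0"
  \<comment> \<open>Both indices are compared with \<open>N\<close>; a third of \<open>e\<close> makes the final inequality strict.\<close>
  define \<epsilon> where "\<epsilon> = e / 3"
  have "\<epsilon> > 0" using \<open>e > 0\<close> by (simp add: \<epsilon>_def)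
  then have "\<epsilon> - \<Phi> \<epsilon> > 0" using below[of \<epsilon>] by simp
  have "\<forall>\<^sub>F n in sequentially. dist ((T ^^ n) x) (T ((T ^^ n) x)) < \<epsilon> - \<Phi> \<epsilon>"
    using order_tendstoD(2)[OF contraction_steps_tendsto_zero[OF inv contr below cont \<open>x \<in> X\<close>]
        \<open>\<epsilon> - \<Phi> \<epsilon> > 0\<close>] .
  then obtain N where N: "dist ((T ^^ N) x) (T ((T ^^ N) x)) < \<epsilon> - \<Phi> \<epsilon>"
    unfolding eventually_sequentially by blast
  have near: "dist ((T ^^ N) x) ((T ^^ n) x) \<le> \<epsilon>" if "n \<ge> N" for n
  proof -
    have "(T ^^ n) x = (T ^^ (n - N)) ((T ^^ N) x)"
      using that funpow_add[of "n - N" N T] by simp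
    moreover have "dist ((T ^^ N) x) ((T ^^ (n - N)) ((T ^^ N) x)) \<le> \<epsilon>"
      using contraction_orbit_in_cball[OF inv contr mono
          funpow_in_invariant_set[OF inv \<open>x \<in> X\<close>], where \<epsilon> = \<epsilon>] N \<open>\<epsilon> > 0\<close>
      by simp
    ultimately show ?thesis by simp
  qed
  show "\<exists>M. \<forall>m\<ge>M. \<forall>n\<ge>M. dist ((T ^^ m) x) ((T ^^ n) x) < e"
  proof (intro exI allI impI)
    fix m n
    assume "m \<ge> N" "n \<ge> N"
    then have "dist ((T ^^ m) x) ((T ^^ n) x) \<le> \<epsilon> + \<epsilon>"
      using near[of m] near[of n] dist_triangle3[of "(T ^^ m) x" "(T ^^ n) x" "(T ^^ N) x"]
      by linarith
    then show "dist ((T ^^ m) x) ((T ^^ n) x) < e"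
      using \<open>e > 0\<close> by (simp add: \<epsilon>_def)
  qed
qed

text \<open>
  The fixed point theorem of Boyd and Wong for a nondecreasing comparison function. Every orbit
  converges to some fixed point; uniqueness then makes the limit independent of the starting point.
\<close>

theorem monotone_Boyd_Wong:
  fixes T :: "'a::metric_space \<Rightarrow> 'a"
  assumes "complete X" and "X \<noteq> {}"
    and inv: "\<And>x. x \<in> X \<Longrightarrow> T x \<in> X"
    and contr: "\<And>x y. x \<in> X \<Longrightarrow> y \<in> X \<Longrightarrow> dist (T x) (T y) \<le> \<Phi> (dist x y)"
    and below: "\<And>r::real. r > 0 \<Longrightarrow> \<Phi> r < r"
    and cont: "continuous_on {0..} \<Phi>" and mono: "mono_on {0..} \<Phi>"
  shows "\<exists>z\<in>X. T z = z \<and> (\<forall>y\<in>X. T y = y \<longrightarrow> y = z) \<and> (\<forall>x\<in>X. (\<lambda>n. (T ^^ n) x) \<longlonglongrightarrow> z)"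
proof -
  have limit: "\<exists>z\<in>X. T z = z \<and> (\<lambda>n. (T ^^ n) x) \<longlonglongrightarrow> z" if x: "x \<in> X" for x
  proof -
    have orbit: "(T ^^ n) x \<in> X" for n
      using inv x by (rule funpow_in_invariant_set)
    obtain z where "z \<in> X" and z: "(\<lambda>n. (T ^^ n) x) \<longlonglongrightarrow> z"
    proof (rule completeE[OF \<open>complete X\<close>])
      show "\<forall>n. (T ^^ n) x \<in> X"
        using orbit by blast
      show "Cauchy (\<lambda>n. (T ^^ n) x)"
        using inv contr below cont mono x by (rule contraction_orbit_Cauchy)
    qed
    have "(\<lambda>n. T ((T ^^ n) x)) \<longlonglongrightarrow> T z"
    proof (rule metric_tendsto_imp_tendsto[OF z])
      show "\<forall>\<^sub>F n in sequentially. dist (T ((T ^^ n) x)) (T z) \<le> dist ((T ^^ n) x) z"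
        using contraction_nonexpansive[OF contr below orbit \<open>z \<in> X\<close>] by simp
    qed
    then have "T z = z"
      using LIMSEQ_unique LIMSEQ_Suc[OF z] by simp
    with \<open>z \<in> X\<close> z show ?thesis by blast
  qed
  have unique: "y = z" if "y \<in> X" "z \<in> X" "T y = y" "T z = z" for y z
    using contr[OF that(1,2)] below[of "dist y z"] that(3,4) by force
  obtain x where "x \<in> X"
    using \<open>X \<noteq> {}\<close> by blast
  then obtain z where z: "z \<in> X" "T z = z"
    using limit by blast
  have "(\<lambda>n. (T ^^ n) x) \<longlonglongrightarrow> z" if x: "x \<in> X" for x
    using limit[OF x] unique z by blast
  with z unique show ?thesis by blast
qed

section \<open>Products of operators with bounded ranges\<close>

lemma norm_le_set_norm:
  assumes "bounded S" and "s \<in> S"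
  shows "norm s \<le> set_norm S"
  unfolding set_norm_def
  using assms by (intro cSUP_upper) (auto simp: bdd_above_norm)

lemma set_norm_nonneg:
  assumes "bounded S" and "S \<noteq> {}"
  shows "set_norm S \<ge> 0"
proof -
  obtain s where "s \<in> S"
    using \<open>S \<noteq> {}\<close> by blast
  then have "norm s \<le> set_norm S"
    using \<open>bounded S\<close> by (simp add: norm_le_set_norm)
  then show ?thesis
    using norm_ge_zero[of s] by linarith
qed

lemma D_Lipschitzian_product_bound:
  fixes A B :: "'a::real_normed_algebra \<Rightarrow> 'a"
  assumes A: "D_Lipschitzian_with \<phi> X A" and B: "D_Lipschitzian_with \<psi> X B"
    and "bounded (A ` X)" and "bounded (B ` X)" and "x \<in> X" and "y \<in> X"
  shows "norm (A x * B x - A y * B y)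
    \<le> set_norm (A ` X) * \<psi> (norm (x - y)) + set_norm (B ` X) * \<phi> (norm (x - y))"
proof -
  have "A x * B x - A y * B y = A x * (B x - B y) + (A x - A y) * B y"
    by (simp add: algebra_simps)
  then have "norm (A x * B x - A y * B y)
      \<le> norm (A x) * norm (B x - B y) + norm (A x - A y) * norm (B y)"
    by (metis add_mono norm_mult_ineq norm_triangle_le)
  also have "\<dots> \<le> set_norm (A ` X) * \<psi> (norm (x - y)) + \<phi> (norm (x - y)) * set_norm (B ` X)"
  proof (intro add_mono mult_mono')
    show "norm (A x) \<le> set_norm (A ` X)" "norm (B y) \<le> set_norm (B ` X)"
      using assms by (auto intro: norm_le_set_norm)
    show "norm (B x - B y) \<le> \<psi> (norm (x - y))" "norm (A x - A y) \<le> \<phi> (norm (x - y))"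
      using assms unfolding D_Lipschitzian_with_def by blast+
  qed simp_all
  finally show ?thesis by (simp add: mult.commute)
qed

theorem theorem3p1:
  fixes X :: "'a::{real_normed_algebra, banach} set"
    and A B :: "'a \<Rightarrow> 'a"
    and \<phi> \<psi> :: "real \<Rightarrow> real"
  assumes "X \<noteq> {}" and "closed X" and "convex X"
    and "D_Lipschitzian_with \<phi> X A" and "D_Lipschitzian_with \<psi> X B"
    and "bounded (A ` X)" and "bounded (B ` X)"
    and "\<And>x. x \<in> X \<Longrightarrow> A x * B x \<in> X"
    and "\<And>r. r > 0 \<Longrightarrow> set_norm (A ` X) * \<psi> r + set_norm (B ` X) * \<phi> r < r"
  shows "\<exists>z\<in>X. A z * B z = z
           \<and> (\<forall>y\<in>X. A y * B y = y \<longrightarrow> y = z)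
           \<and> (\<forall>x\<in>X. (\<lambda>n. (op_prod A B ^^ n) x) \<longlonglongrightarrow> z)"
proof -
  define \<Phi> where "\<Phi> r = set_norm (A ` X) * \<psi> r + set_norm (B ` X) * \<phi> r" for r
  have cont: "continuous_on {0..} \<phi>" "continuous_on {0..} \<psi>"
    and mono: "mono_on {0..} \<phi>" "mono_on {0..} \<psi>"
    using assms(4,5) by (auto simp: D_Lipschitzian_with_def D_function_def)
  have "\<exists>z\<in>X. op_prod A B z = z \<and> (\<forall>y\<in>X. op_prod A B y = y \<longrightarrow> y = z)
      \<and> (\<forall>x\<in>X. (\<lambda>n. (op_prod A B ^^ n) x) \<longlonglongrightarrow> z)"
  proof (rule monotone_Boyd_Wong)
    show "complete X"
      using \<open>closed X\<close> by (simp add: complete_eq_closed)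
    show "dist (op_prod A B x) (op_prod A B y) \<le> \<Phi> (dist x y)" if "x \<in> X" "y \<in> X" for x y
      using D_Lipschitzian_product_bound[OF assms(4-7) that]
      by (simp add: op_prod_def dist_norm \<Phi>_def)
    show "continuous_on {0..} \<Phi>"
      unfolding \<Phi>_def by (intro continuous_intros cont)
    have "0 \<le> set_norm (A ` X)" "0 \<le> set_norm (B ` X)"
      using assms(1,6,7) by (simp_all add: set_norm_nonneg)
    then show "mono_on {0..} \<Phi>"
      unfolding \<Phi>_def using mono
      by (intro mono_onI add_mono mult_left_mono) (auto intro: mono_onD)
    show "X \<noteq> {}" by fact
    show "op_prod A B x \<in> X" if "x \<in> X" for x
      unfolding op_prod_def using assms(8) that .
    show "\<Phi> r < r" if "r > 0" for r
      unfolding \<Phi>_def using assms(9) that .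
  qed
  then show ?thesis by (simp add: op_prod_def)
qed

end
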